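(* Let $1<p<\infty$, $m\in\mathbb{N}$ and $n_1,\ldots,n_m\in\mathbb{N}$ (positive integers). Then the Hardy-type operator $\mathcal{P}_m$ is bounded on $L^p(\mathbb{H}^{n_1}\times\mathbb{H}^{n_2}\times\cdots\times\mathbb{H}^{n_m})$, and its operator norm is $$\|\mathcal{P}_m\|_{L^p(\mathbb{H}^{n_1}\times\cdots\times\mathbb{H}^{n_m})\rightarrow L^p(\mathbb{H}^{n_1}\times\cdots\times\mathbb{H}^{n_m})}=\left(\frac{p}{p-1}\right)^m.$$
   Context: For a positive integer $n$, the Heisenberg group $\mathbb{H}^n$ is the manifold $\mathbb{R}^{2n+1}$ with group law $$x\circ y=\Big(x_1+y_1,\ldots,x_{2n}+y_{2n},\,x_{2n+1}+y_{2n+1}+2\sum_{j=1}^n(y_jx_{n+j}-x_jy_{n+j})\Big).$$ Its Haar measure is Lebesgue measure on $\mathbb{R}^{2n+1}$; $|E|$ denotes the measure of a measurable set $E$. The homogeneous norm is $$|x|_h=\Big[\Big(\sum_{i=1}^{2n}x_i^2\Big)^2+x_{2n+1}^2\Big]^{1/4},$$ and $B(0,r)=\{y\in\mathbb{H}^n:|y|_h<r\}$ for $r>0$. The product $\mathbb{H}^{n_1}\times\cdots\times\mathbb{H}^{n_m}$ carries the product (Lebesgue) measure. For a nonnegative measurable function $f$ on $\mathbb{H}^{n_1}\times\cdots\times\mathbb{H}^{n_m}$, the Hardy-type operator is $$\mathcal{P}_m(f)(x)=\left(\prod_{i=1}^m\frac{1}{|B(0,|x_i|_h)|}\right)\int_{|y_1|_h<|x_1|_h}\cdots\int_{|y_m|_h<|x_m|_h}f(y_1,\ldots,y_m)\,dy_1\cdots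 dy_m,$$ for $x=(x_1,\ldots,x_m)\in\mathbb{H}^{n_1}\times\cdots\times\mathbb{H}^{n_m}$ with $\prod_{i=1}^m|x_i|_h\neq 0$ (hence for almost every $x$), where the ball $B(0,|x_i|_h)$ is taken in $\mathbb{H}^{n_i}$. Boundedness on $L^p$ means that there is a finite constant $C$ with $\|\mathcal{P}_m(f)\|_{L^p}\le C\|f\|_{L^p}$ for every nonnegative $f\in L^p(\mathbb{H}^{n_1}\times\cdots\times\mathbb{H}^{n_m})$; the operator norm is the smallest such $C$. *)

theory Defs
  imports "HOL-Analysis.Analysis"
begin

text \<open>
  A point of the Heisenberg group of dimension \<open>2n+1\<close> is an extensional function
  in \<open>{1..2*n+1} \<rightarrow>\<^sub>E UNIV\<close>, so that the dimension may vary from factor to factor.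
\<close>

type_synonym heis_point = "nat \<Rightarrow> real"

text \<open>
  The group law. Only its Haar measure (Lebesgue measure) and the homogeneous norm
  enter the Hardy-type operator.
\<close>

definition heis_mult :: "nat \<Rightarrow> heis_point \<Rightarrow> heis_point \<Rightarrow> heis_point" where
  "heis_mult n x y = (\<lambda>i\<in>{1..2*n+1}.
     if i \<le> 2*n then x i + y i
     else x i + y i + 2 * (\<Sum>j=1..n. y j * x (n + j) - x j * y (n + j)))"

definition heis_borel :: "nat \<Rightarrow> heis_point measure" where
  "heis_borel n = (\<Pi>\<^sub>M i\<in>{1..2*n+1}. lborel)"

definition heis_lebesgue :: "nat \<Rightarrow> heis_point measure" where
  "heis_lebesgue n = completion (heis_borel n)"

definition heis_norm :: "nat \<Rightarrow> heis_point \<Rightarrow> real" where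
  "heis_norm n x = ((\<Sum>i=1..2*n. (x i)\<^sup>2)\<^sup>2 + (x (2*n+1))\<^sup>2) powr (1/4)"

definition heis_ball :: "nat \<Rightarrow> real \<Rightarrow> heis_point set" where
  "heis_ball n r = {y \<in> {1..2*n+1} \<rightarrow>\<^sub>E UNIV. heis_norm n y < r}"

text \<open>
  Lebesgue measure on the product of the groups of parameters \<open>n 1, \<dots>, n m\<close>,
  i.e. the completion of the product of the Borel-Lebesgue measures.
\<close>

definition heis_prod :: "nat \<Rightarrow> (nat \<Rightarrow> nat) \<Rightarrow> (nat \<Rightarrow> heis_point) measure" where
  "heis_prod m n = completion (\<Pi>\<^sub>M i\<in>{1..m}. heis_borel (n i))"

text \<open>
  The iterated integral over the balls is written as one integral over their product
  (Tonelli). Functions take values in \<open>[0, \<infinity>]\<close>, so no integrability is presupposed.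
  On the null set where some \<open>heis_norm (n i) (x i)\<close> vanishes, the domain of integration
  is empty and the operator returns \<open>0\<close>, as \<open>\<infinity> * 0 = 0\<close> in \<^typ>\<open>ennreal\<close>.
\<close>

definition hardy_op ::
  "nat \<Rightarrow> (nat \<Rightarrow> nat) \<Rightarrow> ((nat \<Rightarrow> heis_point) \<Rightarrow> ennreal) \<Rightarrow> (nat \<Rightarrow> heis_point) \<Rightarrow> ennreal" where
  "hardy_op m n f x =
     (\<Prod>i=1..m. 1 / emeasure (heis_lebesgue (n i)) (heis_ball (n i) (heis_norm (n i) (x i)))) *
     (\<integral>\<^sup>+y\<in>(\<Pi>\<^sub>E i\<in>{1..m}. heis_ball (n i) (heis_norm (n i) (x i))). f y \<partial>heis_prod m n)"

text \<open>Real powers on \<open>[0, \<infinity>]\<close>, meant for positive exponents.\<close>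

definition ennreal_powr :: "ennreal \<Rightarrow> real \<Rightarrow> ennreal" where
  "ennreal_powr x a = (if x = \<infinity> then \<infinity> else ennreal (enn2real x powr a))"

definition Lp_norm :: "'a measure \<Rightarrow> real \<Rightarrow> ('a \<Rightarrow> ennreal) \<Rightarrow> ennreal" where
  "Lp_norm M p f = ennreal_powr (\<integral>\<^sup>+x. ennreal_powr (f x) p \<partial>M) (1 / p)"

definition Lp_nonneg :: "'a measure \<Rightarrow> real \<Rightarrow> ('a \<Rightarrow> ennreal) set" where
  "Lp_nonneg M p = {f \<in> borel_measurable M. Lp_norm M p f < \<infinity>}"

definition Lp_bound ::
  "'a measure \<Rightarrow> real \<Rightarrow> (('a \<Rightarrow> ennreal) \<Rightarrow> 'a \<Rightarrow> ennreal) \<Rightarrow> real \<Rightarrow> bool" where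
  "Lp_bound M p T C \<longleftrightarrow> 0 \<le> C \<and>
     (\<forall>f\<in>Lp_nonneg M p. T f \<in> Lp_nonneg M p \<and> Lp_norm M p (T f) \<le> ennreal C * Lp_norm M p f)"

definition Lp_bounded ::
  "'a measure \<Rightarrow> real \<Rightarrow> (('a \<Rightarrow> ennreal) \<Rightarrow> 'a \<Rightarrow> ennreal) \<Rightarrow> bool" where
  "Lp_bounded M p T \<longleftrightarrow> (\<exists>C. Lp_bound M p T C)"

definition Lp_opnorm ::
  "'a measure \<Rightarrow> real \<Rightarrow> (('a \<Rightarrow> ennreal) \<Rightarrow> 'a \<Rightarrow> ennreal) \<Rightarrow> real" where
  "Lp_opnorm M p T = (LEAST C. Lp_bound M p T C)"

end

theory Submission
  imports Defs
begin

text \<open>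
  Dilations show that balls have volume \<open>c r\<^sup>Q\<close> with \<open>Q = 2n+2\<close>, so the volume \<open>s(x)\<close> of the ball
  \<open>B(0, |x|\<^sub>h)\<close>, as a function of \<open>x\<close>, transports Haar measure to Lebesgue measure on \<open>[0, \<infinity>)\<close>, and
  the operator has the product kernel \<open>\<Prod>i. 1[s(y\<^sub>i) < s(x\<^sub>i)] / s(x\<^sub>i)\<close>. The upper bound is the Schur test
  with weight \<open>\<Prod>i. s(x\<^sub>i) powr (- 1 / p)\<close>: by Tonelli both of its integrals factor into integrals of
  powers on a half-line, and both constants equal \<open>(p / (p - 1))\<^sup>m\<close>. For sharpness, the functions
  \<open>\<Prod>i. s(x\<^sub>i) powr (e - 1 / p)\<close>, restricted to \<open>s(x\<^sub>i) < 1\<close>, lie in \<open>L\<^sup>p\<close> and are mapped pointwise above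
  their multiple by \<open>(1 - 1 / p + e) powr (- m)\<close>; let \<open>e\<close> tend to \<open>0\<close>.
\<close>

section \<open>Jensen's inequality and the Schur test\<close>

lemma ennreal_powr_ennreal [simp]: "0 \<le> x \<Longrightarrow> ennreal_powr (ennreal x) a = ennreal (x powr a)"
  by (simp add: ennreal_powr_def)

lemma ennreal_powr_top [simp]: "ennreal_powr top a = top"
  by (simp add: ennreal_powr_def)

lemma ennreal_powr_mono:
  assumes "0 \<le> a" "x \<le> y"
  shows "ennreal_powr x a \<le> ennreal_powr y a"
  using assms by (cases x; cases y) (auto simp: powr_mono2 top_unique)

lemma ennreal_powr_mult_left:
  assumes "0 \<le> c" "0 < a"
  shows "ennreal_powr (ennreal c * x) a = ennreal (c powr a) * ennreal_powr x a"
proof (cases x)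
  case (real r)
  then show ?thesis using assms by (simp add: powr_mult flip: ennreal_mult)
next
  case top
  then show ?thesis using assms
    \<comment> \<open>For \<open>c = 0\<close> both sides are 0, by \<open>0 * top = 0\<close> and
      \<open>0 powr a = 0\<close>; otherwise both are \<open>top\<close>.\<close>
    by (cases "c = 0") (auto simp: ennreal_mult_top ennreal_powr_def)
qed

lemma ennreal_powr_less_top_iff: "ennreal_powr x a < \<infinity> \<longleftrightarrow> x < \<infinity>"
  by (cases x) auto

lemma borel_measurable_ennreal_powr [measurable]:
  "(\<lambda>x. ennreal_powr x a) \<in> borel_measurable borel"
  unfolding ennreal_powr_def by measurable

text \<open>The upper bound is proved for integrals of p-th powers; here the p-th root is taken
  once.\<close>

lemma Lp_norm_le:
  assumes p: "0 < p" and C: "0 \<le> C"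
    and "(\<integral>\<^sup>+x. ennreal_powr (g x) p \<partial>M) \<le> ennreal (C powr p) * (\<integral>\<^sup>+x. ennreal_powr (f x) p \<partial>M)"
  shows "Lp_norm M p g \<le> ennreal C * Lp_norm M p f"
proof -
  have "Lp_norm M p g \<le> ennreal_powr (ennreal (C powr p) * (\<integral>\<^sup>+x. ennreal_powr (f x) p \<partial>M)) (1 / p)"
    unfolding Lp_norm_def using assms by (intro ennreal_powr_mono) auto
  also have "\<dots> = ennreal C * Lp_norm M p f"
    using p C by (simp add: Lp_norm_def ennreal_powr_mult_left powr_powr)
  finally show ?thesis .
qed

text \<open>\<open>Lp_bound\<close> tests an operator only on measurable functions, and norms and
  measurability see only points of the space.\<close>

lemma Lp_bound_cong:
  assumes "\<And>f x. f \<in> borel_measurable M \<Longrightarrow> x \<in> space M \<Longrightarrow> S f x = T f x"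
  shows "Lp_bound M p S C \<longleftrightarrow> Lp_bound M p T C"
proof -
  have "Lp_norm M p (S f) = Lp_norm M p (T f)"
    and "S f \<in> borel_measurable M \<longleftrightarrow> T f \<in> borel_measurable M"
    if "f \<in> borel_measurable M" for f
    using assms[OF that]
    by (auto simp: Lp_norm_def cong: nn_integral_cong intro!: measurable_cong)
  then show ?thesis
    by (simp add: Lp_bound_def Lp_nonneg_def)
qed

text \<open>The convex function t powr p lies above its tangent at \<open>l\<close>; solved for
  \<open>t\<close>, with equality at \<open>t = l\<close>. The scale \<open>l\<close> stays free so
  that it can be optimised after integration.\<close>

lemma young_scaled:
  fixes p t l :: real
  assumes "1 < p" "0 \<le> t" "0 < l"
  shows "t \<le> l powr (1 - p) / p * t powr p + l * (1 - 1 / p)"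
proof -
  define q where "q = p / (p - 1)"
  have q: "1 < q" "1 / p + 1 / q = 1"
    using assms by (auto simp: q_def field_simps)
  have "t / l \<le> (t / l) powr p / p + 1 / q"
    using Youngs_inequality[OF \<open>1 < p\<close> q, of "t / l" 1] assms by simp
  then have "l * (t / l) \<le> l * ((t / l) powr p / p + 1 / q)"
    using assms by (intro mult_left_mono) auto
  moreover have "1 / q = 1 - 1 / p" using q by simp
  moreover have "l * (t / l) powr p = l powr (1 - p) * t powr p"
    using assms by (simp add: powr_divide powr_diff)
  ultimately show ?thesis
    using assms by (simp add: distrib_left)
qed

text \<open>Jensen's inequality for the density \<open>w\<close>: integrate Young's inequality at the optimal scale
  \<open>l = (r / W) powr (1 / p)\<close>, where \<open>r\<close> is the integral on the right.\<close>

lemma nn_integral_powr_le: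
  fixes p W :: real and w :: "'a \<Rightarrow> ennreal" and \<phi> :: "'a \<Rightarrow> real"
  assumes p: "1 < p" and W: "0 < W" and [measurable]: "w \<in> borel_measurable M" "\<phi> \<in> borel_measurable M"
    and \<phi>: "\<And>x. x \<in> space M \<Longrightarrow> 0 \<le> \<phi> x"
    and w: "(\<integral>\<^sup>+x. w x \<partial>M) \<le> ennreal W"
  shows "ennreal_powr (\<integral>\<^sup>+x. w x * ennreal (\<phi> x) \<partial>M) p
           \<le> ennreal (W powr (p - 1)) * (\<integral>\<^sup>+x. w x * ennreal (\<phi> x powr p) \<partial>M)"
proof -
  let ?J = "\<integral>\<^sup>+x. w x * ennreal (\<phi> x) \<partial>M" and ?I = "\<integral>\<^sup>+x. w x * ennreal (\<phi> x powr p) \<partial>M"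
  show ?thesis
  proof (cases ?I)
    case top
    then show ?thesis using W by (simp add: ennreal_mult_top)
  next
    case (real r)
    show ?thesis
    \<comment> \<open>For \<open>r = 0\<close> the optimal scale would be 0, which
      \<open>young_scaled\<close> excludes; in that case the integrand on the left vanishes almost
      everywhere.\<close>
    proof (cases "r = 0")
      case True
      with real have "?I = 0" by simp
      then have "AE x in M. w x * ennreal (\<phi> x powr p) = 0"
        by (subst nn_integral_0_iff_AE[symmetric]) auto
      then have "AE x in M. w x * ennreal (\<phi> x) = 0"
        by (rule AE_mp) (use \<phi> p in \<open>auto intro!: AE_I2 simp: ennreal_eq_0_iff\<close>)
      then have "?J = 0" by (subst nn_integral_0_iff_AE) auto
      then show ?thesis by (simp add: ennreal_powr_def)
    next
      case False
      with real have r: "0 < r" by simp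
      define l where "l = (r / W) powr (1 / p)"
      have l: "0 < l" using r W by (simp add: l_def)
      have "?J \<le> (\<integral>\<^sup>+x. ennreal (l powr (1 - p) / p) * (w x * ennreal (\<phi> x powr p)) +
                    ennreal (l * (1 - 1 / p)) * w x \<partial>M)"
      proof (intro nn_integral_mono)
        fix x assume x: "x \<in> space M"
        have "w x * ennreal (\<phi> x) \<le> w x * ennreal (l powr (1 - p) / p * \<phi> x powr p + l * (1 - 1 / p))"
          using young_scaled[OF p \<phi>[OF x] l] by (intro mult_left_mono ennreal_leI) auto
        also have "ennreal (l powr (1 - p) / p * \<phi> x powr p + l * (1 - 1 / p)) =
            ennreal (l powr (1 - p) / p) * ennreal (\<phi> x powr p) + ennreal (l * (1 - 1 / p))"
          using p l by (simp add: ennreal_plus flip: ennreal_mult)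
        finally show "w x * ennreal (\<phi> x) \<le> ennreal (l powr (1 - p) / p) * (w x * ennreal (\<phi> x powr p)) +
                    ennreal (l * (1 - 1 / p)) * w x"
          by (simp add: distrib_left mult_ac)
      qed
      also have "\<dots> = ennreal (l powr (1 - p) / p) * ennreal r + ennreal (l * (1 - 1 / p)) * (\<integral>\<^sup>+x. w x \<partial>M)"
        using real by (simp add: nn_integral_add nn_integral_cmult)
      also have "\<dots> \<le> ennreal (l powr (1 - p) / p) * ennreal r + ennreal (l * (1 - 1 / p)) * ennreal W"
        using w by (intro add_left_mono mult_left_mono) auto
      also have "\<dots> = ennreal (l powr (1 - p) / p * r + l * (1 - 1 / p) * W)"
        using p l r W by (simp add: ennreal_plus flip: ennreal_mult)
      \<comment> \<open>Since l powr p = r / W, the first term is l * W / p, and the second supplies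
        the remaining share 1 - 1 / p of l * W.\<close>
      also have "l powr (1 - p) / p * r + l * (1 - 1 / p) * W = l * W"
      proof -
        have "l powr (1 - p) = l / (r / W)"
          using l r W p by (simp add: powr_diff l_def powr_powr)
        then show ?thesis using r W p by (simp add: field_simps)
      qed
      finally have "ennreal_powr ?J p \<le> ennreal_powr (ennreal (l * W)) p"
        using p by (intro ennreal_powr_mono) auto
      also have "\<dots> = ennreal (W powr (p - 1) * r)"
        using l W r p by (simp add: powr_mult powr_diff l_def powr_powr)
      also have "\<dots> = ennreal (W powr (p - 1)) * ?I"
        using real by (simp add: ennreal_mult)
      finally show ?thesis .
    qed
  qed
qed

text \<open>Write the argument as U * (phi / U) and apply Jensen to the density K x y * U y, of mass
  at most A * U x. This leaves the factor (A * U x) powr (p - 1) and the integral of K * phi powr p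
  * U powr (1 - p). After Tonelli, the column bound gives A * U y powr (p - 1), which cancels the
  negative power of U and completes A powr p. Both bounds are asked only where U is positive:
  \<open>0 powr a\<close> is 0, so the weight used below vanishes where it should be infinite, and
  there the column bound can fail.\<close>

theorem schur_test:
  fixes K :: "'a \<Rightarrow> 'a \<Rightarrow> ennreal" and U \<phi> :: "'a \<Rightarrow> real" and p A :: real
  assumes "sigma_finite_measure M" and p: "1 < p" and A: "0 < A"
    and K [measurable]: "(\<lambda>(x, y). K x y) \<in> borel_measurable (M \<Otimes>\<^sub>M M)"
    and [measurable]: "U \<in> borel_measurable M" "\<phi> \<in> borel_measurable M"
    and \<phi>: "\<And>x. x \<in> space M \<Longrightarrow> 0 \<le> \<phi> x"
    and U: "AE x in M. 0 < U x" "\<And>x. x \<in> space M \<Longrightarrow> 0 \<le> U x"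
    and row: "\<And>x. x \<in> space M \<Longrightarrow> 0 < U x \<Longrightarrow> (\<integral>\<^sup>+y. K x y * ennreal (U y) \<partial>M) \<le> ennreal (A * U x)"
    and col: "\<And>y. y \<in> space M \<Longrightarrow> 0 < U y \<Longrightarrow>
      (\<integral>\<^sup>+x. K x y * ennreal (U x powr (p - 1)) \<partial>M) \<le> ennreal (A * U y powr (p - 1))"
  shows "(\<integral>\<^sup>+x. ennreal_powr (\<integral>\<^sup>+y. K x y * ennreal (\<phi> y) \<partial>M) p \<partial>M)
           \<le> ennreal (A powr p) * (\<integral>\<^sup>+y. ennreal (\<phi> y powr p) \<partial>M)"
proof -
  interpret sigma_finite_measure M by fact
  interpret P: pair_sigma_finite M M ..
  let ?g = "\<lambda>y. ennreal (\<phi> y powr p * U y powr (1 - p))"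
  have "(\<integral>\<^sup>+x. ennreal_powr (\<integral>\<^sup>+y. K x y * ennreal (\<phi> y) \<partial>M) p \<partial>M)
      \<le> (\<integral>\<^sup>+x. (\<integral>\<^sup>+y. ennreal (A powr (p - 1)) * ennreal (U x powr (p - 1)) * (K x y * ?g y) \<partial>M) \<partial>M)"
  proof (rule nn_integral_mono_AE, use U(1) AE_space in eventually_elim)
    fix x assume Ux: "0 < U x" and x: "x \<in> space M"
    show "ennreal_powr (\<integral>\<^sup>+y. K x y * ennreal (\<phi> y) \<partial>M) p
      \<le> (\<integral>\<^sup>+y. ennreal (A powr (p - 1)) * ennreal (U x powr (p - 1)) * (K x y * ?g y) \<partial>M)"
    proof -
      note [measurable] = measurable_Pair2[OF K x, unfolded split_conv]
      have "(\<integral>\<^sup>+y. K x y * ennreal (\<phi> y) \<partial>M) = (\<integral>\<^sup>+y. K x y * ennreal (U y) * ennreal (\<phi> y / U y) \<partial>M)"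
      proof (rule nn_integral_cong_AE, use U(1) in eventually_elim)
        case (elim y)
        then have "ennreal (U y) * ennreal (\<phi> y / U y) = ennreal (\<phi> y)"
          by (simp flip: ennreal_mult')
        then show ?case by (simp add: mult.assoc)
      qed
      also have "ennreal_powr \<dots> p \<le> ennreal ((A * U x) powr (p - 1)) *
          (\<integral>\<^sup>+y. K x y * ennreal (U y) * ennreal ((\<phi> y / U y) powr p) \<partial>M)"
        using p A Ux U(2) \<phi> row[OF x Ux] by (intro nn_integral_powr_le) auto
      also have "(\<integral>\<^sup>+y. K x y * ennreal (U y) * ennreal ((\<phi> y / U y) powr p) \<partial>M)
          = (\<integral>\<^sup>+y. K x y * ?g y \<partial>M)"
      proof (rule nn_integral_cong_AE, use U(1) AE_space in eventually_elim)
        case (elim y)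
        then have "ennreal (U y) * ennreal ((\<phi> y / U y) powr p) = ?g y"
          using \<phi>[of y] by (simp add: powr_divide powr_diff mult_ac flip: ennreal_mult')
        then show ?case by (simp add: mult.assoc)
      qed
      also have "ennreal ((A * U x) powr (p - 1)) * (\<integral>\<^sup>+y. K x y * ?g y \<partial>M) =
          (\<integral>\<^sup>+y. ennreal (A powr (p - 1)) * ennreal (U x powr (p - 1)) * (K x y * ?g y) \<partial>M)"
        using A Ux by (subst nn_integral_cmult) (auto simp: powr_mult ennreal_mult)
      finally show ?thesis .
    qed
  qed
  also have "\<dots> = (\<integral>\<^sup>+y. (\<integral>\<^sup>+x. ennreal (A powr (p - 1)) * ennreal (U x powr (p - 1)) * (K x y * ?g y) \<partial>M) \<partial>M)"
    by (rule P.Fubini') measurable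
  also have "\<dots> \<le> (\<integral>\<^sup>+y. ennreal (A powr p) * ennreal (\<phi> y powr p) \<partial>M)"
  proof (rule nn_integral_mono_AE, use U(1) AE_space in eventually_elim)
    fix y assume Uy: "0 < U y" and y: "y \<in> space M"
    show "(\<integral>\<^sup>+x. ennreal (A powr (p - 1)) * ennreal (U x powr (p - 1)) * (K x y * ?g y) \<partial>M)
      \<le> ennreal (A powr p) * ennreal (\<phi> y powr p)"
    proof -
      note [measurable] = measurable_Pair1[OF K y, unfolded split_conv]
      have "(\<integral>\<^sup>+x. ennreal (A powr (p - 1)) * ennreal (U x powr (p - 1)) * (K x y * ?g y) \<partial>M)
        = ennreal (A powr (p - 1)) * ?g y * (\<integral>\<^sup>+x. K x y * ennreal (U x powr (p - 1)) \<partial>M)"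
        by (subst nn_integral_cmult[symmetric]) (auto simp: mult_ac)
      also have "\<dots> \<le> ennreal (A powr (p - 1)) * ?g y * ennreal (A * U y powr (p - 1))"
        using col[OF y Uy] by (intro mult_left_mono) auto
      also have "\<dots> = ennreal (A powr (p - 1) * (\<phi> y powr p * U y powr (1 - p)) * (A * U y powr (p - 1)))"
        using A by (simp add: ennreal_mult)
      also have "A powr (p - 1) * (\<phi> y powr p * U y powr (1 - p)) * (A * U y powr (p - 1)) = A powr p * \<phi> y powr p"
        using A Uy by (simp add: powr_diff)
      finally show ?thesis by (simp add: ennreal_mult)
    qed
  qed
  also have "\<dots> = ennreal (A powr p) * (\<integral>\<^sup>+y. ennreal (\<phi> y powr p) \<partial>M)"
    by (rule nn_integral_cmult) measurable
  finally show ?thesis .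
qed

section \<open>Products of uniform coordinates\<close>

text \<open>The kernel of averaging over [0, a). The strict comparison makes it vanish for a <= 0 <=
  b, so the value of 1 / 0 never enters.\<close>

definition hardy_kernel :: "real \<Rightarrow> real \<Rightarrow> real" where
  "hardy_kernel a b = (if b < a then 1 / a else 0)"

lemma borel_measurable_hardy_kernel [measurable (raw)]:
  assumes [measurable]: "f \<in> borel_measurable M" "g \<in> borel_measurable M"
  shows "(\<lambda>x. hardy_kernel (f x) (g x)) \<in> borel_measurable M"
  unfolding hardy_kernel_def by measurable

lemma hardy_kernel_nonneg: "0 \<le> b \<Longrightarrow> 0 \<le> hardy_kernel a b"
  by (simp add: hardy_kernel_def)

text \<open>The condition on sublevel sets says that \<open>s\<close> pushes \<open>M\<close>
  forward to Lebesgue measure on the half-line; for negative \<open>t\<close> the set is empty and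
  \<open>ennreal t\<close> is 0.\<close>

locale uniform_coordinate =
  fixes M :: "'a measure" and s :: "'a \<Rightarrow> real"
  assumes measurable_s [measurable]: "s \<in> borel_measurable M"
    and s_nonneg: "x \<in> space M \<Longrightarrow> 0 \<le> s x"
    and emeasure_s_less: "emeasure M {x \<in> space M. s x < t} = ennreal t"
begin

text \<open>Measures on the line are compared here through upper rays of finite mass. Upper rays
  have infinite mass under the law of \<open>s\<close>, but finite mass after the change of
  sign.\<close>

lemma distr_uminus_s: "distr M borel (\<lambda>x. - s x) = density lborel (indicator {..0})"
proof (rule measure_eqI_lessThan)
  fix t :: real
  have *: "emeasure (distr M borel (\<lambda>x. - s x)) {t<..} = ennreal (- t)"
    using emeasure_s_less[of "- t"]
    by (subst emeasure_distr) (auto simp: vimage_def Int_def conj_commute less_minus_iff intro!: arg_cong[where f = "emeasure M"])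
  then show "emeasure (distr M borel (\<lambda>x. - s x)) {t<..} < \<infinity>" by simp
  have "emeasure (density lborel (indicator {..0::real})) {t<..} =
      (\<integral>\<^sup>+x. indicator {..0} x * indicator {t<..} x \<partial>lborel)"
    by (rule emeasure_density) auto
  also have "\<dots> = (\<integral>\<^sup>+x. indicator {t<..0} x \<partial>lborel)"
    by (intro nn_integral_cong) (auto simp: indicator_def)
  also have "\<dots> = emeasure lborel {t<..0}"
    by simp
  also have "\<dots> = ennreal (- t)"
    by (cases "t \<le> 0") (auto simp: ennreal_neg)
  finally show "emeasure (distr M borel (\<lambda>x. - s x)) {t<..} = emeasure (density lborel (indicator {..0})) {t<..}"
    by (simp add: *)
qed auto

lemma nn_integral_s:
  assumes [measurable]: "g \<in> borel_measurable borel"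
  shows "(\<integral>\<^sup>+x. g (s x) \<partial>M) = (\<integral>\<^sup>+t. g t * indicator {0..} t \<partial>lborel)"
proof -
  have "(\<integral>\<^sup>+x. g (s x) \<partial>M) = (\<integral>\<^sup>+u. g (- u) \<partial>distr M borel (\<lambda>x. - s x))"
    by (subst nn_integral_distr) auto
  also have "\<dots> = (\<integral>\<^sup>+u. indicator {..0} u * g (- u) \<partial>lborel)"
    unfolding distr_uminus_s by (subst nn_integral_density) auto
  also have "\<dots> = (\<integral>\<^sup>+u. indicator {..0} (- u) * g u \<partial>lborel)"
    by (subst nn_integral_real_affine[where c = "-1" and t = 0]) auto
  also have "\<dots> = (\<integral>\<^sup>+t. g t * indicator {0..} t \<partial>lborel)"
    by (auto intro!: nn_integral_cong simp: indicator_def)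
  finally show ?thesis .
qed

lemma nn_integral_hardy_kernel_left:
  assumes "0 < a" "-1 < e"
  shows "(\<integral>\<^sup>+y. ennreal (hardy_kernel a (s y) * s y powr e) \<partial>M) = ennreal (a powr e / (e + 1))"
proof -
  have "(\<integral>\<^sup>+y. ennreal (hardy_kernel a (s y) * s y powr e) \<partial>M)
      = (\<integral>\<^sup>+t. ennreal (hardy_kernel a t * t powr e) * indicator {0..} t \<partial>lborel)"
    by (rule nn_integral_s) measurable
  \<comment> \<open>The kernel requires t < a while the power is integrated over the closed
    interval; the single point \<open>a\<close> is null.\<close>
  also have "\<dots> = (\<integral>\<^sup>+t. ennreal (1 / a) * (ennreal (t powr e) * indicator {0..a} t) \<partial>lborel)"
    using assms by (intro nn_integral_cong_AE, intro eventually_mono[OF AE_lborel_singleton[of a]])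
       (auto simp: hardy_kernel_def indicator_def simp flip: ennreal_mult)
  also have "\<dots> = ennreal (1 / a) * ennreal (a powr (e + 1) / (e + 1))"
    using nn_integral_has_integral_lebesgue'[OF _ has_integral_powr_from_0[of e a]] assms
    by (subst nn_integral_cmult) auto
  also have "\<dots> = ennreal (a powr e / (e + 1))"
    using assms by (simp add: powr_add flip: ennreal_mult)
  finally show ?thesis .
qed

lemma nn_integral_hardy_kernel_right:
  assumes "0 < b" "e < 0"
  shows "(\<integral>\<^sup>+x. ennreal (hardy_kernel (s x) b * s x powr e) \<partial>M) = ennreal (b powr e / (- e))"
proof -
  have "(\<integral>\<^sup>+x. ennreal (hardy_kernel (s x) b * s x powr e) \<partial>M)
      = (\<integral>\<^sup>+t. ennreal (hardy_kernel t b * t powr e) * indicator {0..} t \<partial>lborel)"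
    by (rule nn_integral_s) measurable
  also have "\<dots> = (\<integral>\<^sup>+t. ennreal (t powr (e - 1)) * indicator {b..} t \<partial>lborel)"
    using assms by (intro nn_integral_cong_AE, intro eventually_mono[OF AE_lborel_singleton[of b]])
       (auto simp: hardy_kernel_def indicator_def powr_diff)
  also have "\<dots> = ennreal (b powr e / (- e))"
    using nn_integral_has_integral_lebesgue'[OF _ has_integral_powr_to_inf[of "e - 1" b]] assms
    by simp
  finally show ?thesis .
qed

end

section \<open>The Hardy operator on a finite product\<close>

text \<open>Each factor enters only through the law of its coordinate \<open>s i\<close>, which is
  the same for all factors; hence the norm depends on nothing but \<open>p\<close> and
  \<open>card I\<close>.\<close>

locale uniform_product = product_sigma_finite M for M :: "'i \<Rightarrow> 'a measure" +
  fixes I :: "'i set" and s :: "'i \<Rightarrow> 'a \<Rightarrow> real"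
  assumes finite_I: "finite I"
    and uniform: "i \<in> I \<Longrightarrow> uniform_coordinate (M i) (s i)"
begin

lemma s_nonneg: "i \<in> I \<Longrightarrow> x \<in> space (PiM I M) \<Longrightarrow> 0 \<le> s i (x i)"
  using uniform_coordinate.s_nonneg[OF uniform, of i "x i"] by (auto simp: space_PiM)

lemma measurable_s [measurable]: "i \<in> I \<Longrightarrow> s i \<in> borel_measurable (M i)"
  using uniform_coordinate.measurable_s[OF uniform] .

lemma measurable_s_component [measurable]: "i \<in> I \<Longrightarrow> (\<lambda>x. s i (x i)) \<in> borel_measurable (PiM I M)"
  by measurable

definition kernel :: "('i \<Rightarrow> 'a) \<Rightarrow> ('i \<Rightarrow> 'a) \<Rightarrow> real" where
  "kernel x y = (\<Prod>i\<in>I. hardy_kernel (s i (x i)) (s i (y i)))"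

text \<open>As \<open>0 powr e = 0\<close> even for negative \<open>e\<close>, the weight is 0 as
  soon as some coordinate is 0; \<open>AE_weight_pos\<close> shows that such points form a null
  set.\<close>

definition weight :: "real \<Rightarrow> ('i \<Rightarrow> 'a) \<Rightarrow> real" where
  "weight e x = (\<Prod>i\<in>I. s i (x i) powr e)"

definition hardy :: "(('i \<Rightarrow> 'a) \<Rightarrow> ennreal) \<Rightarrow> ('i \<Rightarrow> 'a) \<Rightarrow> ennreal" where
  "hardy f x = (\<integral>\<^sup>+y. ennreal (kernel x y) * f y \<partial>PiM I M)"

lemma measurable_kernel [measurable]:
  "(\<lambda>(x, y). kernel x y) \<in> borel_measurable (PiM I M \<Otimes>\<^sub>M PiM I M)"
  unfolding kernel_def split_def
  by (intro borel_measurable_prod borel_measurable_hardy_kernel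
      measurable_compose[OF measurable_fst] measurable_compose[OF measurable_snd] measurable_s_component)

lemma measurable_weight [measurable]: "weight e \<in> borel_measurable (PiM I M)"
  unfolding weight_def by measurable

lemma kernel_nonneg: "y \<in> space (PiM I M) \<Longrightarrow> 0 \<le> kernel x y"
  unfolding kernel_def by (intro prod_nonneg hardy_kernel_nonneg ballI s_nonneg)

lemma weight_nonneg: "0 \<le> weight e x"
  by (simp add: weight_def prod_nonneg)

lemma weight_pos_iff: "x \<in> space (PiM I M) \<Longrightarrow> 0 < weight e x \<longleftrightarrow> (\<forall>i\<in>I. 0 < s i (x i))"
  using finite_I weight_nonneg[of e x] s_nonneg[of _ x]
  by (auto simp: weight_def less_le)

lemma weight_powr: "weight e x powr a = weight (e * a) x"
  by (simp add: weight_def powr_powr flip: prod_powr_distrib)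

text \<open>The exceptional points lie in finitely many cylinders \<open>PiE I (?N i)\<close>. The
  base of each lies in sublevel sets of measure e for every e > 0, so it is null; the remaining
  factors have infinite measure, but \<open>0 * top = 0\<close>.\<close>

lemma AE_weight_pos: "AE x in PiM I M. 0 < weight e x"
proof -
  let ?N = "\<lambda>i j. if j = i then {x \<in> space (M j). s j x \<le> 0} else space (M j)"
  have "PiE I (?N i) \<in> null_sets (PiM I M)" if i: "i \<in> I" for i
  proof
    have meas: "?N i j \<in> sets (M j)" if "j \<in> I" for j
      using that by auto
    show "PiE I (?N i) \<in> sets (PiM I M)"
      using meas finite_I by (intro sets_PiM_I_finite) auto
    interpret uniform_coordinate "M i" "s i" by (rule uniform[OF i])
    have "emeasure (M i) {x \<in> space (M i). s i x \<le> 0} = 0"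
    proof (intro antisym[OF ennreal_le_epsilon zero_le])
      fix e :: real assume "0 < e"
      then show "emeasure (M i) {x \<in> space (M i). s i x \<le> 0} \<le> 0 + ennreal e"
        unfolding emeasure_s_less[symmetric] add_0 by (intro emeasure_mono) auto
    qed
    then show "emeasure (PiM I M) (PiE I (?N i)) = 0"
      using meas finite_I i by (subst emeasure_PiM) auto
  qed
  then have "AE x in PiM I M. \<forall>i\<in>I. x \<notin> PiE I (?N i)"
    using finite_I by (intro AE_finite_allI AE_not_in) auto
  then show ?thesis
  proof (rule AE_mp, intro AE_I2 impI)
    fix x assume x: "x \<in> space (PiM I M)" and N: "\<forall>i\<in>I. x \<notin> PiE I (?N i)"
    have "0 < s i (x i)" if "i \<in> I" for i
    proof (rule ccontr)
      assume "\<not> 0 < s i (x i)"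
      then have "x \<in> PiE I (?N i)"
        using x by (auto simp: space_PiM PiE_iff)
      with N that show False by blast
    qed
    with x show "0 < weight e x" by (simp add: weight_pos_iff)
  qed
qed

text \<open>Tonelli reduces this to one variable. The radii \<open>a i\<close> are free, so that the
  lemma serves both the operator at a point x and the cutoff of the test function, where
  \<open>a i = 1\<close>.\<close>

lemma nn_integral_kernel_left:
  assumes x: "\<And>i. i \<in> I \<Longrightarrow> 0 < a i" and e: "-1 < e"
  shows "(\<integral>\<^sup>+y. ennreal (\<Prod>i\<in>I. hardy_kernel (a i) (s i (y i)) * s i (y i) powr e) \<partial>PiM I M)
    = ennreal ((1 / (e + 1)) ^ card I * (\<Prod>i\<in>I. a i powr e))"
proof -
  have "(\<integral>\<^sup>+y. ennreal (\<Prod>i\<in>I. hardy_kernel (a i) (s i (y i)) * s i (y i) powr e) \<partial>PiM I M)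
    = (\<integral>\<^sup>+y. (\<Prod>i\<in>I. ennreal (hardy_kernel (a i) (s i (y i)) * s i (y i) powr e)) \<partial>PiM I M)"
    by (intro nn_integral_cong prod_ennreal[symmetric] mult_nonneg_nonneg hardy_kernel_nonneg s_nonneg) auto
  also have "\<dots> = (\<Prod>i\<in>I. \<integral>\<^sup>+t. ennreal (hardy_kernel (a i) (s i t) * s i t powr e) \<partial>M i)"
    by (rule product_nn_integral_prod[OF finite_I]) measurable
  also have "\<dots> = (\<Prod>i\<in>I. ennreal (1 / (e + 1) * a i powr e))"
    by (intro prod.cong refl)
       (simp add: uniform_coordinate.nn_integral_hardy_kernel_left[OF uniform x e])
  also have "\<dots> = ennreal (\<Prod>i\<in>I. 1 / (e + 1) * a i powr e)"
    using e by (intro prod_ennreal) auto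
  finally show ?thesis
    by (simp only: prod.distrib prod_constant)
qed

lemma nn_integral_kernel_right:
  assumes x: "\<And>i. i \<in> I \<Longrightarrow> 0 < b i" and e: "e < 0"
  shows "(\<integral>\<^sup>+x. ennreal (\<Prod>i\<in>I. hardy_kernel (s i (x i)) (b i) * s i (x i) powr e) \<partial>PiM I M)
    = ennreal ((1 / - e) ^ card I * (\<Prod>i\<in>I. b i powr e))"
proof -
  have "(\<integral>\<^sup>+x. ennreal (\<Prod>i\<in>I. hardy_kernel (s i (x i)) (b i) * s i (x i) powr e) \<partial>PiM I M)
    = (\<integral>\<^sup>+x. (\<Prod>i\<in>I. ennreal (hardy_kernel (s i (x i)) (b i) * s i (x i) powr e)) \<partial>PiM I M)"
    using x by (intro nn_integral_cong prod_ennreal[symmetric] mult_nonneg_nonneg hardy_kernel_nonneg) (auto intro: less_imp_le)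
  also have "\<dots> = (\<Prod>i\<in>I. \<integral>\<^sup>+t. ennreal (hardy_kernel (s i t) (b i) * s i t powr e) \<partial>M i)"
    by (rule product_nn_integral_prod[OF finite_I]) measurable
  also have "\<dots> = (\<Prod>i\<in>I. ennreal (1 / - e * b i powr e))"
    by (intro prod.cong refl)
       (simp add: uniform_coordinate.nn_integral_hardy_kernel_right[OF uniform x e])
  also have "\<dots> = ennreal (\<Prod>i\<in>I. 1 / - e * b i powr e)"
    using e by (intro prod_ennreal mult_nonneg_nonneg) auto
  finally show ?thesis
    by (simp only: prod.distrib prod_constant)
qed

lemma measurable_hardy [measurable]:
  assumes [measurable]: "f \<in> borel_measurable (PiM I M)"
  shows "hardy f \<in> borel_measurable (PiM I M)"
proof -
  interpret sigma_finite_measure "PiM I M" by (rule sigma_finite[OF finite_I])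
  show ?thesis unfolding hardy_def by measurable
qed

text \<open>Allows a function measurable for the completion to be replaced by a representative
  measurable for the product itself.\<close>

lemma hardy_cong_AE: "AE y in PiM I M. f y = g y \<Longrightarrow> hardy f = hardy g"
  unfolding hardy_def by (intro ext nn_integral_cong_AE) auto

section \<open>The upper bound\<close>

lemma hardy_inequality:
  assumes p: "1 < p" and [measurable]: "\<phi> \<in> borel_measurable (PiM I M)"
    and \<phi>: "\<And>x. x \<in> space (PiM I M) \<Longrightarrow> 0 \<le> \<phi> x"
  shows "(\<integral>\<^sup>+x. ennreal_powr (hardy (\<lambda>y. ennreal (\<phi> y)) x) p \<partial>PiM I M)
    \<le> ennreal (((p / (p - 1)) ^ card I) powr p) * (\<integral>\<^sup>+y. ennreal (\<phi> y powr p) \<partial>PiM I M)"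
  unfolding hardy_def
\<comment> \<open>For a weight of exponent -g, each factor contributes 1 / (1 - g) to the row
  constant and 1 / (g * (p - 1)) to the column constant. They agree exactly at g = 1 / p, with value
  p / (p - 1).\<close>
proof (rule schur_test[where U = "weight (- (1 / p))"])
  fix x assume x: "x \<in> space (PiM I M)" "0 < weight (- (1 / p)) x"
  have "(\<integral>\<^sup>+y. ennreal (kernel x y) * ennreal (weight (- (1 / p)) y) \<partial>PiM I M)
    = (\<integral>\<^sup>+y. ennreal (\<Prod>i\<in>I. hardy_kernel (s i (x i)) (s i (y i)) * s i (y i) powr (- (1 / p))) \<partial>PiM I M)"
    by (intro nn_integral_cong) (simp add: kernel_def weight_def prod.distrib prod_nonneg flip: ennreal_mult'')
  also have "\<dots> = ennreal ((p / (p - 1)) ^ card I * weight (- (1 / p)) x)"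
    using x(2) p unfolding weight_pos_iff[OF x(1)]
    by (subst nn_integral_kernel_left) (auto simp: weight_def field_simps)
  finally show "(\<integral>\<^sup>+y. ennreal (kernel x y) * ennreal (weight (- (1 / p)) y) \<partial>PiM I M)
    \<le> ennreal ((p / (p - 1)) ^ card I * weight (- (1 / p)) x)" by simp
next
  fix y assume y: "y \<in> space (PiM I M)" "0 < weight (- (1 / p)) y"
  have "(\<integral>\<^sup>+x. ennreal (kernel x y) * ennreal (weight (- (1 / p)) x powr (p - 1)) \<partial>PiM I M)
    = (\<integral>\<^sup>+x. ennreal (\<Prod>i\<in>I. hardy_kernel (s i (x i)) (s i (y i)) * s i (x i) powr (- (1 / p) * (p - 1))) \<partial>PiM I M)"
    unfolding weight_powr
    by (intro nn_integral_cong) (simp add: kernel_def weight_def prod.distrib prod_nonneg flip: ennreal_mult'')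
  also have "\<dots> = ennreal ((p / (p - 1)) ^ card I * weight (- (1 / p)) y powr (p - 1))"
    using y(2) p unfolding weight_powr weight_pos_iff[OF y(1)]
    by (subst nn_integral_kernel_right) (auto simp: weight_def divide_less_0_iff)
  finally show "(\<integral>\<^sup>+x. ennreal (kernel x y) * ennreal (weight (- (1 / p)) x powr (p - 1)) \<partial>PiM I M)
    \<le> ennreal ((p / (p - 1)) ^ card I * weight (- (1 / p)) y powr (p - 1))" by simp
qed (use p \<phi> sigma_finite[OF finite_I] AE_weight_pos weight_nonneg in auto)

abbreviation "lebesgue_prod \<equiv> completion (PiM I M)"

text \<open>Here f is measurable only for the completion and may be infinite. It is exchanged first
  for a product-measurable g, then for the real function \<open>enn2real\<close> of g, since finite
  norm makes g finite almost everywhere. Neither exchange alters \<open>hardy f\<close>, which is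
  therefore also measurable.\<close>

lemma Lp_bound_hardy:
  assumes p: "1 < p"
  shows "Lp_bound lebesgue_prod p hardy ((p / (p - 1)) ^ card I)"
  unfolding Lp_bound_def
proof (intro conjI ballI)
  show C: "0 \<le> (p / (p - 1)) ^ card I" using p by simp
  fix f :: "_ \<Rightarrow> ennreal" assume f: "f \<in> Lp_nonneg lebesgue_prod p"
  then have "f \<in> borel_measurable lebesgue_prod" by (simp add: Lp_nonneg_def)
  then obtain g where g [measurable]: "g \<in> borel_measurable (PiM I M)" and fg: "AE x in PiM I M. f x = g x"
    using completion_ex_borel_measurable by blast
  define \<phi> where "\<phi> x = enn2real (g x)" for x
  have [measurable]: "\<phi> \<in> borel_measurable (PiM I M)" unfolding \<phi>_def by measurable
  have norm_eq: "(\<integral>\<^sup>+x. ennreal_powr (f x) p \<partial>lebesgue_prod) = (\<integral>\<^sup>+x. ennreal_powr (g x) p \<partial>PiM I M)"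
    unfolding nn_integral_completion using fg by (intro nn_integral_cong_AE) auto
  have "(\<integral>\<^sup>+x. ennreal_powr (g x) p \<partial>PiM I M) < \<infinity>"
    using f by (simp add: Lp_nonneg_def Lp_norm_def ennreal_powr_less_top_iff[unfolded infinity_ennreal_def] norm_eq)
  then have "AE x in PiM I M. ennreal_powr (g x) p \<noteq> \<infinity>"
    by (intro nn_integral_noteq_infinite) auto
  then have g\<phi>: "AE x in PiM I M. g x = ennreal (\<phi> x)"
    by (rule AE_mp)
       (auto intro!: AE_I2 simp: \<phi>_def less_top ennreal_powr_less_top_iff[unfolded infinity_ennreal_def])
  have hardy_f: "hardy f = hardy (\<lambda>x. ennreal (\<phi> x))"
    using fg g\<phi> by (intro hardy_cong_AE) auto
  have "(\<integral>\<^sup>+x. ennreal_powr (hardy f x) p \<partial>PiM I M)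
      \<le> ennreal (((p / (p - 1)) ^ card I) powr p) * (\<integral>\<^sup>+y. ennreal (\<phi> y powr p) \<partial>PiM I M)"
    unfolding hardy_f using p by (intro hardy_inequality) (auto simp: \<phi>_def)
  also have "(\<integral>\<^sup>+y. ennreal (\<phi> y powr p) \<partial>PiM I M) = (\<integral>\<^sup>+x. ennreal_powr (f x) p \<partial>lebesgue_prod)"
    unfolding norm_eq
  proof (rule nn_integral_cong_AE, use g\<phi> in eventually_elim)
    case (elim x)
    then show ?case by (metis \<phi>_def ennreal_powr_ennreal enn2real_nonneg)
  qed
  finally show le: "Lp_norm lebesgue_prod p (hardy f) \<le> ennreal ((p / (p - 1)) ^ card I) * Lp_norm lebesgue_prod p f"
    using p C by (intro Lp_norm_le) (auto simp: nn_integral_completion)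
  have "Lp_norm lebesgue_prod p f < \<infinity>" using f by (simp add: Lp_nonneg_def)
  then have "ennreal ((p / (p - 1)) ^ card I) * Lp_norm lebesgue_prod p f < \<infinity>"
    by (simp add: ennreal_mult_less_top)
  moreover have "hardy f \<in> borel_measurable lebesgue_prod"
    unfolding hardy_f by (intro measurable_completion) measurable
  ultimately show "hardy f \<in> Lp_nonneg lebesgue_prod p"
    using le by (simp add: Lp_nonneg_def)
qed

section \<open>The lower bound\<close>

text \<open>The test function is \<open>\<Prod>i. s i powr (e - 1 / p)\<close>, cut off to \<open>s i < 1\<close> by the factors
  \<open>hardy_kernel 1 (s i)\<close>.\<close>

lemma Lp_bound_hardy_lower_aux:
  assumes p: "1 < p" and e: "0 < e" and C: "Lp_bound lebesgue_prod p hardy C"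
  shows "(1 / (1 - 1 / p + e)) ^ card I \<le> C"
proof -
  \<comment> \<open>In one variable the average of t powr (e - 1 / p) over (0, a) is a multiple of a
    powr (e - 1 / p); \<open>b\<close> is the product of these multiples.\<close>
  define b where "b = (1 / (1 - 1 / p + e)) ^ card I"
  have d: "-1 < e - 1 / p" "0 < 1 - 1 / p + e" using p e divide_less_eq_1_pos[of p 1] by linarith+
  have b: "0 \<le> b" and b_eq: "b = (1 / (e - 1 / p + 1)) ^ card I"
    using d by (simp_all add: b_def algebra_simps)
  define f where "f y = (\<Prod>i\<in>I. hardy_kernel 1 (s i (y i)) * s i (y i) powr (e - 1 / p))" for y
  have [measurable]: "f \<in> borel_measurable (PiM I M)" unfolding f_def by measurable
  have f0: "0 \<le> f y" if "y \<in> space (PiM I M)" for y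
    unfolding f_def using that by (intro prod_nonneg ballI mult_nonneg_nonneg hardy_kernel_nonneg s_nonneg) auto
  \<comment> \<open>For nonnegative second argument \<open>hardy_kernel 1\<close> takes only the
    values 0 and 1, so it equals its own p-th power. The exponent e * p - 1 exceeds -1, which puts
    \<open>f\<close> in the space.\<close>
  have "f y powr p = (\<Prod>i\<in>I. hardy_kernel 1 (s i (y i)) * s i (y i) powr (e * p - 1))" for y
  proof -
    have "f y powr p = (\<Prod>i\<in>I. (hardy_kernel 1 (s i (y i)) * s i (y i) powr (e - 1 / p)) powr p)"
      unfolding f_def by (rule prod_powr_distrib)
    also have "\<dots> = (\<Prod>i\<in>I. hardy_kernel 1 (s i (y i)) * s i (y i) powr (e * p - 1))"
      using p by (intro prod.cong refl) (auto simp: hardy_kernel_def powr_powr left_diff_distrib)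
    finally show ?thesis .
  qed
  then have "(\<integral>\<^sup>+y. ennreal_powr (ennreal (f y)) p \<partial>PiM I M)
    = (\<integral>\<^sup>+y. ennreal (\<Prod>i\<in>I. hardy_kernel 1 (s i (y i)) * s i (y i) powr (e * p - 1)) \<partial>PiM I M)"
    using f0 by (intro nn_integral_cong) simp
  also have "\<dots> = ennreal ((1 / (e * p)) ^ card I)"
    using p e by (subst nn_integral_kernel_left) auto
  finally have int_f: "(\<integral>\<^sup>+y. ennreal_powr (ennreal (f y)) p \<partial>PiM I M) = ennreal ((1 / (e * p)) ^ card I)" .
  define L where "L = ((1 / (e * p)) ^ card I) powr (1 / p)"
  have L: "0 < L" using p e by (simp add: L_def)
  have norm_f: "Lp_norm lebesgue_prod p (\<lambda>y. ennreal (f y)) = ennreal L"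
    using p e by (simp add: Lp_norm_def nn_integral_completion int_f L_def)
  have f_mem: "(\<lambda>y. ennreal (f y)) \<in> Lp_nonneg lebesgue_prod p"
    by (auto simp: Lp_nonneg_def norm_f intro!: measurable_completion)
  \<comment> \<open>If all coordinates of x are below 1, the kernel reaches only points where the
    cutoff is 1, and \<open>f\<close> is reproduced with factor \<open>b\<close>. Elsewhere, and
    where a coordinate is 0, \<open>f x = 0\<close>.\<close>
  have eigen: "ennreal (b * f x) \<le> hardy (\<lambda>y. ennreal (f y)) x" if x: "x \<in> space (PiM I M)" for x
  proof (cases "\<forall>i\<in>I. 0 < s i (x i) \<and> s i (x i) < 1")
    case True
    have "hardy (\<lambda>y. ennreal (f y)) x =
      (\<integral>\<^sup>+y. ennreal (\<Prod>i\<in>I. hardy_kernel (s i (x i)) (s i (y i)) * s i (y i) powr (e - 1 / p)) \<partial>PiM I M)"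
      unfolding hardy_def
    proof (intro nn_integral_cong)
      fix y assume y: "y \<in> space (PiM I M)"
      have "kernel x y * f y = (\<Prod>i\<in>I. hardy_kernel (s i (x i)) (s i (y i)) * s i (y i) powr (e - 1 / p))"
        unfolding kernel_def f_def prod.distrib[symmetric]
        using True by (intro prod.cong refl) (auto simp: hardy_kernel_def)
      then show "ennreal (kernel x y) * ennreal (f y) =
          ennreal (\<Prod>i\<in>I. hardy_kernel (s i (x i)) (s i (y i)) * s i (y i) powr (e - 1 / p))"
        using kernel_nonneg[OF y] f0[OF y] by (simp flip: ennreal_mult)
    qed
    also have "\<dots> = ennreal (b * f x)"
      using True d by (subst nn_integral_kernel_left) (auto simp: b_eq f_def hardy_kernel_def)
    finally show ?thesis by simp
  next
    case False
    then obtain i where i: "i \<in> I" "s i (x i) = 0 \<or> 1 \<le> s i (x i)"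
      using s_nonneg[OF _ x] by force
    then have "hardy_kernel 1 (s i (x i)) * s i (x i) powr (e - 1 / p) = 0"
      by (auto simp: hardy_kernel_def)
    then have "f x = 0"
      unfolding f_def using finite_I i by (intro prod_zero) blast+
    then show ?thesis by simp
  qed
  have "ennreal (b powr p) * ennreal ((1 / (e * p)) ^ card I)
      = (\<integral>\<^sup>+x. ennreal_powr (ennreal (b * f x)) p \<partial>PiM I M)"
    unfolding int_f[symmetric] using b p
    by (subst nn_integral_cmult[symmetric])
       (auto simp: ennreal_mult' ennreal_powr_mult_left intro!: nn_integral_cong)
  also have "\<dots> \<le> (\<integral>\<^sup>+x. ennreal_powr (hardy (\<lambda>y. ennreal (f y)) x) p \<partial>PiM I M)"
    using eigen p by (intro nn_integral_mono ennreal_powr_mono) auto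
  finally have "ennreal_powr (ennreal (b powr p) * ennreal ((1 / (e * p)) ^ card I)) (1 / p)
      \<le> Lp_norm lebesgue_prod p (hardy (\<lambda>y. ennreal (f y)))"
    unfolding Lp_norm_def nn_integral_completion using p by (intro ennreal_powr_mono) auto
  also have "\<dots> \<le> ennreal C * ennreal L"
    using C f_mem unfolding Lp_bound_def norm_f[symmetric] by blast
  also have "ennreal_powr (ennreal (b powr p) * ennreal ((1 / (e * p)) ^ card I)) (1 / p) = ennreal (b * L)"
    using b p e by (simp add: ennreal_powr_mult_left powr_powr L_def ennreal_mult)
  finally have "b * L \<le> C * L"
    using C L b by (simp add: Lp_bound_def flip: ennreal_mult)
  then show ?thesis using L by (simp add: b_def)
qed

lemma Lp_bound_hardy_lower:
  assumes p: "1 < p" and C: "Lp_bound lebesgue_prod p hardy C"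
  shows "(p / (p - 1)) ^ card I \<le> C"
proof (rule tendsto_upperbound)
  have "((\<lambda>e. (1 / (1 - 1 / p + e)) ^ card I) \<longlongrightarrow> (1 / (1 - 1 / p + 0)) ^ card I) (at_right 0)"
    using p by (intro tendsto_intros) auto
  then show "((\<lambda>e. (1 / (1 - 1 / p + e)) ^ card I) \<longlongrightarrow> (p / (p - 1)) ^ card I) (at_right 0)"
    using p by (simp add: field_simps)
  show "eventually (\<lambda>e. (1 / (1 - 1 / p + e)) ^ card I \<le> C) (at_right 0)"
    using Lp_bound_hardy_lower_aux[OF p _ C] by (auto simp: eventually_at_right_less intro: eventually_mono[OF eventually_at_right_less])
qed simp

theorem Lp_opnorm_hardy:
  assumes "1 < p"
  shows "Lp_opnorm lebesgue_prod p hardy = (p / (p - 1)) ^ card I"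
  unfolding Lp_opnorm_def
  using assms by (intro Least_equality Lp_bound_hardy Lp_bound_hardy_lower)

end

section \<open>The volume of Heisenberg balls\<close>

lemma emeasure_lborel_scale:
  fixes c :: real
  assumes "c \<noteq> 0" and [measurable]: "A \<in> sets borel"
  shows "emeasure lborel A = ennreal \<bar>c\<bar> * emeasure lborel ((\<lambda>x. c * x) -` A)"
proof -
  have [measurable]: "(\<lambda>x. c * x) -` A \<in> sets borel"
    using measurable_sets[of "\<lambda>x. c * x" borel borel A] by simp
  have "emeasure lborel A = ennreal \<bar>c\<bar> * (\<integral>\<^sup>+x. indicator A (0 + c * x) \<partial>lborel)"
    using assms by (subst nn_integral_real_affine[symmetric]) auto
  also have "(\<integral>\<^sup>+x. indicator A (0 + c * x) \<partial>lborel) = (\<integral>\<^sup>+x. indicator ((\<lambda>x. c * x) -` A) x \<partial>lborel)"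
    by (intro nn_integral_cong) (simp add: indicator_def)
  finally show ?thesis by simp
qed

text \<open>The pushforward under the diagonal map, times the determinant, agrees with the product
  measure on boxes, which determine it. Each axis has its own factor because Heisenberg dilations
  are anisotropic.\<close>

lemma emeasure_PiM_lborel_scale:
  fixes c :: "'i \<Rightarrow> real"
  assumes I: "finite I" and c: "\<And>i. i \<in> I \<Longrightarrow> 0 < c i" and A: "A \<in> sets (PiM I (\<lambda>_. lborel))"
  shows "emeasure (PiM I (\<lambda>_. lborel)) A = ennreal (\<Prod>i\<in>I. c i) *
    emeasure (PiM I (\<lambda>_. lborel)) {x \<in> space (PiM I (\<lambda>_. lborel)). (\<lambda>i\<in>I. c i * x i) \<in> A}"
proof -
  interpret product_sigma_finite "\<lambda>_::'i. lborel :: real measure" ..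
  let ?P = "PiM I (\<lambda>_. lborel :: real measure)" and ?D = "\<lambda>x. \<lambda>i\<in>I. c i * x i"
  have [measurable]: "?D \<in> ?P \<rightarrow>\<^sub>M ?P"
    by measurable
  have "density (distr ?P ?P ?D) (\<lambda>_. ennreal (\<Prod>i\<in>I. c i)) = ?P"
  proof (rule PiM_eqI[OF I])
    fix B :: "'i \<Rightarrow> real set" assume B: "\<And>i. i \<in> I \<Longrightarrow> B i \<in> sets lborel"
    have B' [measurable]: "(\<lambda>x. c i * x) -` B i \<in> sets borel" if "i \<in> I" for i
      using measurable_sets[of "\<lambda>x. c i * x" borel borel "B i"] B[OF that] by simp
    have "emeasure (density (distr ?P ?P ?D) (\<lambda>_. ennreal (\<Prod>i\<in>I. c i))) (PiE I B)
        = ennreal (\<Prod>i\<in>I. c i) * emeasure ?P (?D -` PiE I B \<inter> space ?P)"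
      using B I by (subst emeasure_density_const) (auto simp: emeasure_distr intro!: sets_PiM_I_finite)
    also have "?D -` PiE I B \<inter> space ?P = (\<Pi>\<^sub>E i\<in>I. (\<lambda>x. c i * x) -` B i)"
      by (auto simp: space_PiM PiE_iff)
    also have "emeasure ?P \<dots> = (\<Prod>i\<in>I. emeasure lborel ((\<lambda>x. c i * x) -` B i))"
      using B' by (intro emeasure_PiM I) auto
    also have "ennreal (\<Prod>i\<in>I. c i) * \<dots> = (\<Prod>i\<in>I. ennreal (c i) * emeasure lborel ((\<lambda>x. c i * x) -` B i))"
      using c by (subst prod_ennreal[symmetric]) (auto simp: prod.distrib less_imp_le)
    also have "\<dots> = (\<Prod>i\<in>I. emeasure lborel (B i))"
    proof (rule prod.cong)
      fix i assume "i \<in> I"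
      then show "ennreal (c i) * emeasure lborel ((\<lambda>x. c i * x) -` B i) = emeasure lborel (B i)"
        using emeasure_lborel_scale[of "c i" "B i"] c[of i] B[of i] by simp
    qed simp
    finally show "emeasure (density (distr ?P ?P ?D) (\<lambda>_. ennreal (\<Prod>i\<in>I. c i))) (PiE I B)
        = (\<Prod>i\<in>I. emeasure lborel (B i))" .
  qed simp
  then have "emeasure ?P A = emeasure (density (distr ?P ?P ?D) (\<lambda>_. ennreal (\<Prod>i\<in>I. c i))) A"
    by simp
  also have "\<dots> = ennreal (\<Prod>i\<in>I. c i) * emeasure ?P (?D -` A \<inter> space ?P)"
    using A by (subst emeasure_density_const) (auto simp: emeasure_distr)
  also have "?D -` A \<inter> space ?P = {x \<in> space ?P. ?D x \<in> A}" by auto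
  finally show ?thesis .
qed

section \<open>Balls of the homogeneous norm\<close>

lemma sigma_finite_heis_borel: "sigma_finite_measure (heis_borel n)"
proof -
  interpret product_sigma_finite "\<lambda>_::nat. lborel :: real measure" ..
  show ?thesis unfolding heis_borel_def by (rule sigma_finite) simp
qed

lemma space_heis_borel: "space (heis_borel n) = {1..2*n+1} \<rightarrow>\<^sub>E UNIV"
  by (simp add: heis_borel_def space_PiM)

lemma measurable_heis_norm [measurable]: "heis_norm n \<in> borel_measurable (heis_borel n)"
  unfolding heis_norm_def heis_borel_def by measurable

lemma heis_norm_nonneg: "0 \<le> heis_norm n x"
  by (simp add: heis_norm_def)

lemma heis_ball_eq: "heis_ball n r = {x \<in> space (heis_borel n). heis_norm n x < r}"
  by (simp add: heis_ball_def space_heis_borel)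

lemma sets_heis_ball [measurable]: "heis_ball n r \<in> sets (heis_borel n)"
  unfolding heis_ball_eq by measurable

text \<open>With the last coordinate scaled by the square of r, both terms under the fourth root
  scale by r ^ 4.\<close>

lemma heis_norm_dilation:
  assumes "0 < r"
  shows "heis_norm n (\<lambda>i\<in>{1..2*n+1}. (if i \<le> 2*n then r else r\<^sup>2) * x i) = r * heis_norm n x"
proof -
  have "(\<Sum>i=1..2*n. ((\<lambda>i\<in>{1..2*n+1}. (if i \<le> 2*n then r else r\<^sup>2) * x i) i)\<^sup>2) = r\<^sup>2 * (\<Sum>i=1..2*n. (x i)\<^sup>2)"
    by (simp add: sum_distrib_left power_mult_distrib)
  then have "heis_norm n (\<lambda>i\<in>{1..2*n+1}. (if i \<le> 2*n then r else r\<^sup>2) * x i)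
      = (r ^ 4 * ((\<Sum>i=1..2*n. (x i)\<^sup>2)\<^sup>2 + (x (2*n+1))\<^sup>2)) powr (1/4)"
    unfolding heis_norm_def by (simp add: power_mult_distrib distrib_left flip: power_mult)
  also have "\<dots> = (r ^ 4) powr (1/4) * heis_norm n x"
    unfolding heis_norm_def by (rule powr_mult)
  also have "(r ^ 4) powr (1/4) = r"
    using assms by (simp add: powr_powr flip: powr_numeral)
  finally show ?thesis .
qed

definition unit_ball_volume :: "nat \<Rightarrow> real" where
  "unit_ball_volume n = measure (heis_borel n) (heis_ball n 1)"

lemma emeasure_heis_box: "emeasure (heis_borel n) ({1..2*n+1} \<rightarrow>\<^sub>E {- d..d}) = ennreal (2 * d) ^ (2*n+1)"
proof -
  interpret product_sigma_finite "\<lambda>_::nat. lborel :: real measure" ..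
  show ?thesis
    unfolding heis_borel_def by (subst emeasure_PiM) (cases "0 \<le> d"; auto simp: ennreal_neg)+
qed

lemma heis_norm_less_1_iff: "heis_norm n x < 1 \<longleftrightarrow> (\<Sum>i=1..2*n. (x i)\<^sup>2)\<^sup>2 + (x (2*n+1))\<^sup>2 < 1"
proof -
  define X where "X = (\<Sum>i=1..2*n. (x i)\<^sup>2)\<^sup>2 + (x (2*n+1))\<^sup>2"
  have "0 \<le> X" by (simp add: X_def)
  moreover have "1 \<le> X powr (1/4)" if "1 \<le> X"
    using that by (simp add: ge_one_powr_ge_zero)
  moreover have "X powr (1/4) < 1" if "X < 1"
    using that \<open>0 \<le> X\<close> powr_less_mono2[of "1/4" X 1] by simp
  ultimately show ?thesis
    unfolding heis_norm_def X_def[symmetric] by linarith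
qed

text \<open>The ball lies in a cube: the last coordinate and the sum of the other squares are both
  at most 1 in absolute value.\<close>

lemma emeasure_heis_unit_ball_finite: "emeasure (heis_borel n) (heis_ball n 1) < \<infinity>"
proof -
  have "heis_ball n 1 \<subseteq> ({1..2*n+1} \<rightarrow>\<^sub>E {-1..1})"
  proof
    fix x assume x: "x \<in> heis_ball n 1"
    let ?S = "\<Sum>i=1..2*n. (x i)\<^sup>2"
    have less: "?S\<^sup>2 + (x (2*n+1))\<^sup>2 < 1"
      using x by (simp add: heis_ball_def heis_norm_less_1_iff)
    have "(x i)\<^sup>2 \<le> 1" if i: "i \<in> {1..2*n+1}" for i
    proof (cases "i = 2*n+1")
      case True
      then show ?thesis
        using less zero_le_power2[of ?S] unfolding True by linarith
    next
      case False
      then have "(x i)\<^sup>2 \<le> ?S"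
        using i by (intro member_le_sum) auto
      moreover have "?S\<^sup>2 \<le> 1"
        using less zero_le_power2[of "x (2*n+1)"] by linarith
      then have "?S \<le> 1" by (simp add: power2_le_iff_abs_le sum_nonneg abs_square_le_1)
      ultimately show ?thesis by linarith
    qed
    then show "x \<in> {1..2*n+1} \<rightarrow>\<^sub>E {-1..1}"
      using x by (auto simp: heis_ball_def PiE_iff abs_square_le_1 abs_le_iff)
  qed
  then have "emeasure (heis_borel n) (heis_ball n 1) \<le> emeasure (heis_borel n) ({1..2*n+1} \<rightarrow>\<^sub>E {-1..1})"
    by (rule emeasure_mono) (auto simp: heis_borel_def intro!: sets_PiM_I_finite)
  also have "\<dots> < \<infinity>"
    unfolding emeasure_heis_box infinity_ennreal_def power_less_top_ennreal by simp
  finally show ?thesis .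
qed

lemma emeasure_heis_unit_ball_pos: "0 < emeasure (heis_borel n) (heis_ball n 1)"
proof -
  \<comment> \<open>This half-width gives 2 * n * d <= 1, so the sum of squares is at most d, and d
    <= 1 / 2, so the total stays below 2 * d * d <= 1 / 2.\<close>
  define d where "d = 1 / (2 * real n + 2)"
  have d: "0 < d" "d \<le> 1 / 2" "2 * real n * d \<le> 1" by (auto simp: d_def field_simps)
  have "({1..2*n+1} \<rightarrow>\<^sub>E {- d..d}) \<subseteq> heis_ball n 1"
  proof
    fix x assume x: "x \<in> {1..2*n+1} \<rightarrow>\<^sub>E {- d..d}"
    let ?S = "\<Sum>i=1..2*n. (x i)\<^sup>2"
    have sq: "(x i)\<^sup>2 \<le> d\<^sup>2" if "i \<in> {1..2*n+1}" for i
      using x that d by (auto simp: PiE_iff abs_le_iff minus_le_iff intro!: power2_le_iff_abs_le[THEN iffD2])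
    have "?S \<le> real (card {1..2*n}) * d\<^sup>2"
      by (rule sum_bounded_above) (rule sq, simp)
    also have "\<dots> = (2 * real n * d) * d" by (simp add: power2_eq_square)
    also have "\<dots> \<le> 1 * d" using d by (intro mult_right_mono) auto
    finally have "?S\<^sup>2 \<le> d\<^sup>2" by (intro power_mono) (auto intro: sum_nonneg)
    moreover have "(x (2*n+1))\<^sup>2 \<le> d\<^sup>2" by (rule sq) simp
    moreover have "d\<^sup>2 \<le> (1/2)\<^sup>2" using d by (intro power_mono) auto
    ultimately have "?S\<^sup>2 + (x (2*n+1))\<^sup>2 < 1" by (simp add: power2_eq_square)
    then show "x \<in> heis_ball n 1"
      using x by (auto simp: heis_ball_def heis_norm_less_1_iff PiE_iff)
  qed
  then have "emeasure (heis_borel n) ({1..2*n+1} \<rightarrow>\<^sub>E {- d..d}) \<le> emeasure (heis_borel n) (heis_ball n 1)"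
    by (rule emeasure_mono) (rule sets_heis_ball)
  moreover have "0 < ennreal (2 * d) ^ (2*n+1)"
    using d by (simp add: ennreal_power del: power_Suc)
  ultimately show ?thesis
    unfolding emeasure_heis_box by (rule less_le_trans[rotated])
qed

lemma unit_ball_volume_pos: "0 < unit_ball_volume n"
  using emeasure_heis_unit_ball_pos[of n] emeasure_heis_unit_ball_finite[of n]
  by (simp add: unit_ball_volume_def measure_def enn2real_positive_iff)

text \<open>For r > 0 the dilation maps the unit ball onto the ball of radius r, with Jacobian r ^
  (2*n) times r ^ 2.\<close>

lemma emeasure_heis_ball:
  assumes "0 \<le> r"
  shows "emeasure (heis_borel n) (heis_ball n r) = ennreal (unit_ball_volume n * r ^ (2*n+2))"
proof (cases "r = 0")
  case True
  then have "heis_ball n r = {}"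
    using heis_norm_nonneg[of n] by (auto simp: heis_ball_def not_less)
  then show ?thesis using True by simp
next
  case False
  with assms have r: "0 < r" by simp
  let ?c = "\<lambda>i. if i \<le> 2*n then r else r\<^sup>2"
  have "emeasure (heis_borel n) (heis_ball n r) = ennreal (\<Prod>i\<in>{1..2*n+1}. ?c i) *
      emeasure (heis_borel n) {x \<in> space (heis_borel n). (\<lambda>i\<in>{1..2*n+1}. ?c i * x i) \<in> heis_ball n r}"
    using sets_heis_ball[of n r] r unfolding heis_borel_def
    by (intro emeasure_PiM_lborel_scale) auto
  also have "{x \<in> space (heis_borel n). (\<lambda>i\<in>{1..2*n+1}. ?c i * x i) \<in> heis_ball n r} = heis_ball n 1"
    unfolding heis_ball_eq mem_Collect_eq heis_norm_dilation[OF r]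
    using r by (auto simp: space_heis_borel)
  also have "(\<Prod>i\<in>{1..2*n+1}. ?c i) = r ^ (2*n+2)"
    by (simp add: power_add power2_eq_square)
  also have "emeasure (heis_borel n) (heis_ball n 1) = ennreal (unit_ball_volume n)"
    using emeasure_heis_unit_ball_finite[of n] by (simp add: unit_ball_volume_def emeasure_eq_ennreal_measure less_top)
  finally show ?thesis
    using r unit_ball_volume_pos[of n] by (simp add: mult.commute flip: ennreal_mult)
qed

text \<open>The volume of B(0, |x|_h), by \<open>emeasure_heis_ball\<close>. It increases strictly
  with the norm, so membership in balls can be read off from volumes.\<close>

definition heis_volume :: "nat \<Rightarrow> heis_point \<Rightarrow> real" where
  "heis_volume n x = unit_ball_volume n * heis_norm n x ^ (2*n+2)"

lemma heis_volume_nonneg: "0 \<le> heis_volume n x"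
  unfolding heis_volume_def using unit_ball_volume_pos[of n] heis_norm_nonneg[of n x]
  by (intro mult_nonneg_nonneg) auto

lemma heis_volume_less_iff: "heis_volume n y < heis_volume n x \<longleftrightarrow> heis_norm n y < heis_norm n x"
  unfolding heis_volume_def using unit_ball_volume_pos[of n] heis_norm_nonneg[of n]
  by (auto simp del: power_Suc simp: power_strict_mono intro: power_less_imp_less_base)

lemma emeasure_heis_lebesgue_ball:
  "emeasure (heis_lebesgue n) (heis_ball n (heis_norm n x)) = ennreal (heis_volume n x)"
  using sets_heis_ball[of n]
  by (simp add: heis_lebesgue_def heis_volume_def emeasure_heis_ball heis_norm_nonneg del: power_Suc)

text \<open>For t > 0 the sublevel set is itself a ball, with radius chosen so that its volume is
  t.\<close>

lemma emeasure_heis_volume_less: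
  "emeasure (heis_borel n) {x \<in> space (heis_borel n). heis_volume n x < t} = ennreal t"
proof (cases "0 < t")
  case False
  then have "{x \<in> space (heis_borel n). heis_volume n x < t} = {}"
    using heis_volume_nonneg[of n] by (auto simp: not_less intro: order_trans)
  then show ?thesis using False by (simp only: emeasure_empty) (simp add: ennreal_neg)
next
  case True
  note c = unit_ball_volume_pos[of n]
  define r where "r = root (2*n+2) (t / unit_ball_volume n)"
  have r: "0 \<le> r" using True c by (simp add: r_def)
  have "r ^ (2*n+2) = t / unit_ball_volume n"
    unfolding r_def using True c by (intro real_root_pow_pos2) auto
  then have t: "unit_ball_volume n * r ^ (2*n+2) = t"
    using c by (simp add: field_simps)
  have "heis_volume n x < t \<longleftrightarrow> heis_norm n x < r" for x
    unfolding heis_volume_def t[symmetric] using c r heis_norm_nonneg[of n x]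
    by (auto simp del: power_Suc simp: power_strict_mono intro: power_less_imp_less_base)
  then show ?thesis
    using emeasure_heis_ball[OF r, of n] unfolding t by (simp add: heis_ball_eq)
qed

section \<open>The Hardy operator on products of Heisenberg groups\<close>

lemma uniform_coordinate_heis: "uniform_coordinate (heis_borel n) (heis_volume n)"
proof
  show "heis_volume n \<in> borel_measurable (heis_borel n)"
    unfolding heis_volume_def by measurable
qed (simp_all add: heis_volume_nonneg emeasure_heis_volume_less)

lemma uniform_product_heis:
  fixes n :: "nat \<Rightarrow> nat"
  shows "uniform_product (\<lambda>i. heis_borel (n i)) {1..m} (\<lambda>i. heis_volume (n i))"
  by (intro uniform_product.intro uniform_product_axioms.intro product_sigma_finite.intro
      sigma_finite_heis_borel uniform_coordinate_heis) auto

text \<open>The reciprocal volumes times the indicator of the product of balls form the product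
  kernel; passing to the completion does not change the integral.\<close>

lemma hardy_op_eq:
  assumes f [measurable]: "f \<in> borel_measurable (heis_prod m n)"
    and x: "x \<in> space (heis_prod m n)"
  shows "hardy_op m n f x =
    uniform_product.hardy (\<lambda>i. heis_borel (n i)) {1..m} (\<lambda>i. heis_volume (n i)) f x"
proof -
  interpret uniform_product "\<lambda>i. heis_borel (n i)" "{1..m}" "\<lambda>i. heis_volume (n i)"
    by (rule uniform_product_heis)
  let ?s = "\<lambda>i. heis_volume (n i) (x i)"
  let ?B = "\<Pi>\<^sub>E i\<in>{1..m}. heis_ball (n i) (heis_norm (n i) (x i))"
  have mem_B: "y \<in> ?B \<longleftrightarrow> (\<forall>i\<in>{1..m}. heis_volume (n i) (y i) < ?s i)" if "y \<in> space (heis_prod m n)" for y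
    using that by (auto simp: heis_prod_def space_PiM PiE_iff heis_ball_eq heis_volume_less_iff)
  have kernel_eq: "kernel x y = (\<Prod>i=1..m. 1 / ?s i) * indicator ?B y" if y: "y \<in> space (heis_prod m n)" for y
  proof (cases "y \<in> ?B")
    case True
    then show ?thesis
      using mem_B[OF y] unfolding kernel_def by (simp add: hardy_kernel_def)
  next
    case False
    then obtain i where "i \<in> {1..m}" "\<not> heis_volume (n i) (y i) < ?s i"
      using mem_B[OF y] by blast
    then have "kernel x y = 0"
      unfolding kernel_def by (intro prod_zero bexI[of _ i]) (auto simp: hardy_kernel_def)
    then show ?thesis using False by simp
  qed
  have B: "?B \<in> sets (heis_prod m n)"
    unfolding heis_prod_def by (intro sets_completionI_sets sets_PiM_I_finite) auto
  have op: "hardy_op m n f x = (\<Prod>i=1..m. 1 / ennreal (?s i)) * (\<integral>\<^sup>+y\<in>?B. f y \<partial>heis_prod m n)"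
    by (simp add: hardy_op_def emeasure_heis_lebesgue_ball)
  have hardy: "hardy f x = (\<integral>\<^sup>+y. ennreal (kernel x y) * f y \<partial>heis_prod m n)"
    unfolding hardy_def heis_prod_def nn_integral_completion ..
  show ?thesis
  \<comment> \<open>For zero volume \<open>1 / ennreal 0\<close> is \<open>top\<close> while the
    real quotient is 0, so the two forms cannot be matched factor by factor. Then, however, one ball
    is empty and both integrals vanish.\<close>
  proof (cases "\<forall>i\<in>{1..m}. 0 < ?s i")
    case True
    then have "(\<Prod>i=1..m. 1 / ennreal (?s i)) = (\<Prod>i=1..m. ennreal (1 / ?s i))"
      by (intro prod.cong refl) (simp add: divide_ennreal flip: ennreal_1)
    also have "\<dots> = ennreal (\<Prod>i=1..m. 1 / ?s i)"
      using True by (intro prod_ennreal) (auto simp: less_imp_le)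
    finally have "hardy_op m n f x = (\<integral>\<^sup>+y. ennreal (\<Prod>i=1..m. 1 / ?s i) * (f y * indicator ?B y) \<partial>heis_prod m n)"
      unfolding op using B by (subst nn_integral_cmult) auto
    also have "\<dots> = hardy f x"
      unfolding hardy by (intro nn_integral_cong) (simp add: kernel_eq indicator_def del: One_nat_def)
    finally show ?thesis .
  next
    case False
    then obtain i where i: "i \<in> {1..m}" "?s i = 0"
      using heis_volume_nonneg by (metis less_le)
    then have empty: "y \<notin> ?B" if "y \<in> space (heis_prod m n)" for y
      using mem_B[OF that] heis_volume_nonneg[of "n i" "y i"] by force
    have "(\<integral>\<^sup>+y\<in>?B. f y \<partial>heis_prod m n) = (\<integral>\<^sup>+y. 0 \<partial>heis_prod m n)"
      using empty by (intro nn_integral_cong) simp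
    moreover have "hardy f x = (\<integral>\<^sup>+y. 0 \<partial>heis_prod m n)"
      unfolding hardy using empty by (intro nn_integral_cong) (simp add: kernel_eq del: One_nat_def)
    ultimately show ?thesis by (simp add: op)
  qed
qed

theorem theorem1:
  fixes p :: real and m :: nat and n :: "nat \<Rightarrow> nat"
  assumes "1 < p" and "1 \<le> m" and "\<And>i. i \<in> {1..m} \<Longrightarrow> 1 \<le> n i"
  shows "Lp_bounded (heis_prod m n) p (hardy_op m n) \<and>
         Lp_opnorm (heis_prod m n) p (hardy_op m n) = (p / (p - 1)) ^ m"
proof -
  interpret uniform_product "\<lambda>i. heis_borel (n i)" "{1..m}" "\<lambda>i. heis_volume (n i)"
    by (rule uniform_product_heis)
  \<comment> \<open>Having the equivalence for every \<open>C\<close> transfers boundedness and the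
    least constant together.\<close>
  have eq: "Lp_bound (heis_prod m n) p (hardy_op m n) C \<longleftrightarrow> Lp_bound lebesgue_prod p hardy C" for C
    unfolding heis_prod_def[symmetric] by (rule Lp_bound_cong) (rule hardy_op_eq)
  show ?thesis
    using Lp_bound_hardy[OF \<open>1 < p\<close>] Lp_opnorm_hardy[OF \<open>1 < p\<close>]
    unfolding Lp_bounded_def Lp_opnorm_def eq by auto
qed

end
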